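(* Let $I\subset\mathbb{R}$ be an interval with interior $I^{\circ}$, let $a,b\in I^{\circ}$ with $a<b$, and let $f:I\to\mathbb{R}$ be twice differentiable on $I^{\circ}$ with $f,f',f''\in L[a,b]$. Let $\alpha,\lambda\in[0,1]$. Suppose $|f''|$ is convex on $[a,b]$. Put $$E=(b-a)\left(\alpha-\tfrac12\right)f'\big((1-\alpha)b+\alpha a\big)-\frac{1}{b-a}\int_a^b f(x)\,dx+(1-\lambda)f\big((1-\alpha)b+\alpha a\big)+\lambda\big(\alpha f(a)+(1-\alpha)f(b)\big).$$ Then, with the constants $\gamma_i,\mu_i$ ($i=1,2,3,4$) given in the context: (i) if $2\alpha\lambda\le 1-\alpha\le 1-2\lambda(1-\alpha)$, then $|E|\le \frac{(b-a)^2}{2}\left\{(\gamma_1+\mu_1)|f''(b)|+(\gamma_2+\mu_2)|f''(a)|\right\}$; (ii) if $1-\alpha\ge\max\{2\alpha\lambda,\,1-2\lambda(1-\alpha)\}$, then $|E|\le \frac{(b-a)^2}{2}\left\{(\gamma_1+\mu_3)|f''(b)|+(\gamma_2+\mu_4)|f''(a)|\right\}$; (iii) if $1-\alpha\le\min\{2\alpha\lambda,\,1-2\lambda(1-\alpha)\}$, then $|E|\le \frac{(b-a)^2}{2}\left\{(\gamma_3+\mu_1)|f''(b)|+(\gamma_4+\mu_2)|f''(a)|\right\}$; (iv) if $1-2\lambda(1-\alpha)\le 1-\alpha\le 2\alpha\lambda$, then $|E|\le \frac{(b-a)^2}{2}\left\{(\gamma_3+\mu_3)|f''(b)|+(\g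amma_4+\mu_4)|f''(a)|\right\}$.
   Context: $L[a,b]$ denotes the Lebesgue integrable real-valued functions on $[a,b]$. The constants are $$\gamma_1=\tfrac83(\alpha\lambda)^4+(1-\alpha)^3\left(\tfrac{1-\alpha}{4}-\tfrac{2\alpha\lambda}{3}\right),$$ $$\gamma_2=\tfrac83(\alpha\lambda)^3(1-\alpha\lambda)+(1-\alpha)^2\left[\tfrac{1-\alpha}{3}-\alpha\lambda-\tfrac{(1-\alpha)^2}{4}+\tfrac{2\alpha\lambda(1-\alpha)}{3}\right],$$ $$\gamma_3=\tfrac{2\alpha\lambda(1-\alpha)^3}{3}-\tfrac{(1-\alpha)^4}{4},$$ $$\gamma_4=(1-\alpha)^2\left[\alpha\lambda-\tfrac{1-\alpha}{3}-\tfrac{2\alpha\lambda(1-\alpha)}{3}+\tfrac{(1-\alpha)^2}{4}\right],$$ $$\mu_1=\tfrac43(1-\alpha)^3\lambda^3\big(1-\lambda(1-\alpha)\big)-\tfrac1{12}\big(\alpha-2\lambda(1-\alpha)\big)^2\left[\alpha(3\alpha-4)-4\lambda(1-\alpha)^2(1-\lambda)\right],$$ $$\mu_2=\tfrac43(1-\alpha)^4\lambda^4+\tfrac1{12}\big(\alpha-2\lambda(1-\alpha)\big)^2\left[\alpha^2(4\lambda^2-4\lambda+3)+4\alpha\lambda(1-2\lambda)+4\lambda^2\right],$$ $$\mu_3=\tfrac43(1-\alpha)^3\lambda^3\big(1-\lambda(1-\alpha)\big)+\tfrac1{12}\big(\alpha-2\lambda(1-\alpha)\big)^2\left[\alpha(3\alpha-4)-4\lambda(1-\alpha)^2(1-\lambda)\right],$$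 $$\mu_4=\tfrac43(1-\alpha)^4\lambda^4-\tfrac1{12}\big(\alpha-2\lambda(1-\alpha)\big)^2\left[\alpha^2(4\lambda^2-4\lambda+3)+4\alpha\lambda(1-2\lambda)+4\lambda^2\right].$$ *)

theory Defs
  imports "HOL-Analysis.Analysis"
begin

(* Let c = (1 - \<alpha>) b + \<alpha> a.  Integrating by parts twice on [a, c] and on [c, b] writes E as
   (b - a)^2 / 2 times the integral over t in [0, 1] of k(t) f''(t b + (1 - t) a), where
     k(t) = t (2 \<alpha> lam - t)                            on [0, 1 - \<alpha>],
     k(t) = (1 - t) (2 lam (1 - \<alpha>) - (1 - t))           on [1 - \<alpha>, 1].
   The gammas are the integrals over [0, 1 - \<alpha>] of |k(t)| t (odd index) and |k(t)| (1 - t)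
   (even index): indices 1, 2 if 2 \<alpha> lam \<le> 1 - \<alpha>, indices 3, 4 otherwise.
   The mus are the same integrals over [1 - \<alpha>, 1]:
   indices 1, 2 if 1 - \<alpha> \<le> 1 - 2 lam (1 - \<alpha>), indices 3, 4 otherwise. *)

definition \<gamma>\<^sub>1 :: "real \<Rightarrow> real \<Rightarrow> real" where
  "\<gamma>\<^sub>1 \<alpha> lam = 8/3 * (\<alpha> * lam)^4
     + (1 - \<alpha>)^3 * ((1 - \<alpha>) / 4 - 2 * \<alpha> * lam / 3)"

definition \<gamma>\<^sub>2 :: "real \<Rightarrow> real \<Rightarrow> real" where
  "\<gamma>\<^sub>2 \<alpha> lam = 8/3 * (\<alpha> * lam)^3 * (1 - \<alpha> * lam)
     + (1 - \<alpha>)^2 * ((1 - \<alpha>) / 3 - \<alpha> * lam - (1 - \<alpha>)^2 / 4 + 2 * \<alpha> * lam * (1 - \<alpha>) / 3)"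

definition \<gamma>\<^sub>3 :: "real \<Rightarrow> real \<Rightarrow> real" where
  "\<gamma>\<^sub>3 \<alpha> lam = 2 * \<alpha> * lam * (1 - \<alpha>)^3 / 3 - (1 - \<alpha>)^4 / 4"

definition \<gamma>\<^sub>4 :: "real \<Rightarrow> real \<Rightarrow> real" where
  "\<gamma>\<^sub>4 \<alpha> lam = (1 - \<alpha>)^2
     * (\<alpha> * lam - (1 - \<alpha>) / 3 - 2 * \<alpha> * lam * (1 - \<alpha>) / 3 + (1 - \<alpha>)^2 / 4)"

definition \<mu>\<^sub>1 :: "real \<Rightarrow> real \<Rightarrow> real" where
  "\<mu>\<^sub>1 \<alpha> lam = 4/3 * (1 - \<alpha>)^3 * lam^3 * (1 - lam * (1 - \<alpha>))
     - 1/12 * (\<alpha> - 2 * lam * (1 - \<alpha>))^2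
         * (\<alpha> * (3 * \<alpha> - 4) - 4 * lam * (1 - \<alpha>)^2 * (1 - lam))"

definition \<mu>\<^sub>2 :: "real \<Rightarrow> real \<Rightarrow> real" where
  "\<mu>\<^sub>2 \<alpha> lam = 4/3 * (1 - \<alpha>)^4 * lam^4
     + 1/12 * (\<alpha> - 2 * lam * (1 - \<alpha>))^2
         * (\<alpha>^2 * (4 * lam^2 - 4 * lam + 3) + 4 * \<alpha> * lam * (1 - 2 * lam) + 4 * lam^2)"

definition \<mu>\<^sub>3 :: "real \<Rightarrow> real \<Rightarrow> real" where
  "\<mu>\<^sub>3 \<alpha> lam = 4/3 * (1 - \<alpha>)^3 * lam^3 * (1 - lam * (1 - \<alpha>))
     + 1/12 * (\<alpha> - 2 * lam * (1 - \<alpha>))^2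
         * (\<alpha> * (3 * \<alpha> - 4) - 4 * lam * (1 - \<alpha>)^2 * (1 - lam))"

definition \<mu>\<^sub>4 :: "real \<Rightarrow> real \<Rightarrow> real" where
  "\<mu>\<^sub>4 \<alpha> lam = 4/3 * (1 - \<alpha>)^4 * lam^4
     - 1/12 * (\<alpha> - 2 * lam * (1 - \<alpha>))^2
         * (\<alpha>^2 * (4 * lam^2 - 4 * lam + 3) + 4 * \<alpha> * lam * (1 - 2 * lam) + 4 * lam^2)"

(* The argument f' is the derivative of f. *)
definition E :: "(real \<Rightarrow> real) \<Rightarrow> (real \<Rightarrow> real) \<Rightarrow> real \<Rightarrow> real \<Rightarrow> real \<Rightarrow> real \<Rightarrow> real" where
  "E f f' a b \<alpha> lam =
     (b - a) * (\<alpha> - 1/2) * f' ((1 - \<alpha>) * b + \<alpha> * a)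
     - 1 / (b - a) * (LINT x:{a..b}|lebesgue. f x)
     + (1 - lam) * f ((1 - \<alpha>) * b + \<alpha> * a)
     + lam * (\<alpha> * f a + (1 - \<alpha>) * f b)"

end

theory Submission
  imports Defs
begin

text \<open>
  Rescale \<open>[a, b]\<close> to \<open>[0, 1]\<close> and write \<open>g\<close> for the rescaled \<open>f\<close> and \<open>G\<close> for a primitive of \<open>g\<close>.
  For \<open>k t = t (2 p - t)\<close>, the function \<open>k g' - k' g - 2 G\<close> has derivative \<open>k g''\<close>, and by convexity
  \<open>\<bar>k g''\<bar>\<close> is at most \<open>\<bar>k\<bar>\<close> times the linear interpolation of \<open>\<bar>g''\<bar>\<close> at the end points.
  Comparing the increments on the intervals where \<open>k\<close> has constant sign bounds the contribution of
  \<open>[0, 1 - \<alpha>]\<close>. The contribution of \<open>[1 - \<alpha>, 1]\<close> is the same one for the reflected function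
  \<open>t \<mapsto> g (1 - t)\<close> with \<open>\<alpha>\<close> and \<open>1 - \<alpha>\<close> exchanged.
\<close>

section \<open>Primitives attached to the kernel k(t) = t (2 p - t)\<close>

definition kernel_primitive :: "real \<Rightarrow> real \<Rightarrow> real \<Rightarrow> real \<Rightarrow> real" where
  "kernel_primitive p A B t =
     B * (2 * p * t^3 / 3 - t^4 / 4) + A * (p * t^2 - (1 + 2 * p) * t^3 / 3 + t^4 / 4)"

lemma kernel_primitive_deriv:
  "(kernel_primitive p A B has_real_derivative t * (2 * p - t) * (t * B + (1 - t) * A)) (at t)"
  unfolding kernel_primitive_def
  by (rule derivative_eq_intros refl | simp)+ (simp add: algebra_simps power2_eq_square power3_eq_cube)

lemma kernel_primitive_0 [simp]: "kernel_primitive p A B 0 = 0"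
  by (simp add: kernel_primitive_def)

text \<open>Integrating k g'' by parts twice leaves this expression. The parameter \<open>p\<close>
  stays free because the left piece uses \<alpha> lam and the reflected right piece uses lam (1 -
  \<alpha>).\<close>

definition parts :: "real \<Rightarrow> (real \<Rightarrow> real) \<Rightarrow> (real \<Rightarrow> real) \<Rightarrow> (real \<Rightarrow> real) \<Rightarrow> real \<Rightarrow> real" where
  "parts p g\<^sub>1 g G t = t * (2 * p - t) * g\<^sub>1 t - (2 * p - 2 * t) * g t - 2 * G t"

section \<open>Increment bounds on the unit interval, and reflection\<close>

locale second_derivative_bound =
  fixes G g g\<^sub>1 g\<^sub>2 :: "real \<Rightarrow> real" and A B :: real
  assumes G_deriv: "\<And>t. 0 < t \<Longrightarrow> t < 1 \<Longrightarrow> (G has_real_derivative g t) (at t)"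
    and g_deriv: "\<And>t. 0 < t \<Longrightarrow> t < 1 \<Longrightarrow> (g has_real_derivative g\<^sub>1 t) (at t)"
    and g\<^sub>1_deriv: "\<And>t. 0 < t \<Longrightarrow> t < 1 \<Longrightarrow> (g\<^sub>1 has_real_derivative g\<^sub>2 t) (at t)"
    and G_cont: "continuous_on {0..1} G"
    and g_cont: "continuous_on {0..1} g"
    and g\<^sub>1_cont: "continuous_on {0..1} g\<^sub>1"
    and g\<^sub>2_bound: "\<And>t. 0 < t \<Longrightarrow> t < 1 \<Longrightarrow> \<bar>g\<^sub>2 t\<bar> \<le> t * B + (1 - t) * A"
begin

text \<open>With k' = 2 p - 2 t and k'' = -2, the two terms k' g' cancel, and the 2 g produced by
  k'' cancels against 2 G'.\<close>

lemma parts_deriv: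
  assumes "0 < t" "t < 1"
  shows "(parts p g\<^sub>1 g G has_real_derivative t * (2 * p - t) * g\<^sub>2 t) (at t)"
  unfolding parts_def
  by (auto intro!: derivative_eq_intros G_deriv g_deriv g\<^sub>1_deriv assms simp: algebra_simps)

lemma parts_cont:
  assumes "{u..v} \<subseteq> {0..1}"
  shows "continuous_on {u..v} (parts p g\<^sub>1 g G)"
  unfolding parts_def
  by (intro continuous_intros continuous_on_subset[OF G_cont assms]
      continuous_on_subset[OF g_cont assms] continuous_on_subset[OF g\<^sub>1_cont assms])

text \<open>Since \<sigma> is the sign of k on the interval, |k g''| is at most the derivative of
  \<sigma> times \<open>kernel_primitive\<close>. The mean value inequality compares the increments
  without integrating g''.\<close>

lemma parts_diff_bound:
  assumes uv: "0 \<le> u" "u \<le> v" "v \<le> 1"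
    and \<sigma>: "\<bar>\<sigma>\<bar> = 1"
    and sign: "\<And>t. u < t \<Longrightarrow> t < v \<Longrightarrow> 0 \<le> \<sigma> * (t * (2 * p - t))"
  shows "\<bar>parts p g\<^sub>1 g G v - parts p g\<^sub>1 g G u\<bar>
           \<le> \<sigma> * (kernel_primitive p A B v - kernel_primitive p A B u)"
\<comment> \<open>The mean value inequality needs u < v, but degenerate intervals do occur, for
  instance when the sign change sits at an end point.\<close>
proof (cases "u = v")
  case False
  then have "u < v" using uv by simp
  have "norm (parts p g\<^sub>1 g G v - parts p g\<^sub>1 g G u)
          \<le> \<sigma> * kernel_primitive p A B v - \<sigma> * kernel_primitive p A B u"
  proof (rule differentiable_bound_general[OF \<open>u < v\<close>])
    show "continuous_on {u..v} (parts p g\<^sub>1 g G)"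
      using uv by (intro parts_cont) auto
    show "continuous_on {u..v} (\<lambda>t. \<sigma> * kernel_primitive p A B t)"
      unfolding kernel_primitive_def by (intro continuous_intros) auto
  next
    fix t assume t: "u < t" "t < v"
    then have t01: "0 < t" "t < 1" using uv by auto
    show "(parts p g\<^sub>1 g G has_vector_derivative t * (2 * p - t) * g\<^sub>2 t) (at t)"
      using parts_deriv[OF t01]
      by (simp add: has_real_derivative_iff_has_vector_derivative)
    show "((\<lambda>t. \<sigma> * kernel_primitive p A B t) has_vector_derivative
             \<sigma> * (t * (2 * p - t) * (t * B + (1 - t) * A))) (at t)"
      using DERIV_cmult[OF kernel_primitive_deriv]
      by (simp add: has_real_derivative_iff_has_vector_derivative)
    have "\<bar>t * (2 * p - t)\<bar> = \<sigma> * (t * (2 * p - t))"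
      using sign[OF t] \<sigma> by (metis abs_mult abs_of_nonneg mult_1)
    then have "norm (t * (2 * p - t) * g\<^sub>2 t) = \<sigma> * (t * (2 * p - t)) * \<bar>g\<^sub>2 t\<bar>"
      by (metis abs_mult real_norm_def)
    also have "\<dots> \<le> \<sigma> * (t * (2 * p - t)) * (t * B + (1 - t) * A)"
      using sign[OF t] g\<^sub>2_bound[OF t01] by (intro mult_left_mono)
    finally show "norm (t * (2 * p - t) * g\<^sub>2 t)
        \<le> \<sigma> * (t * (2 * p - t) * (t * B + (1 - t) * A))"
      by (simp add: mult.assoc)
  qed
  then show ?thesis by (simp add: right_diff_distrib)
qed simp

text \<open>The zero 2 p lies at or beyond m, so k is nonnegative on all of [0, m].\<close>

lemma parts_bound_late_sign_change:
  assumes "0 \<le> m" "m \<le> 1" "m \<le> 2 * p"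
  shows "\<bar>parts p g\<^sub>1 g G m - parts p g\<^sub>1 g G 0\<bar> \<le> kernel_primitive p A B m"
proof -
  have "\<bar>parts p g\<^sub>1 g G m - parts p g\<^sub>1 g G 0\<bar>
      \<le> 1 * (kernel_primitive p A B m - kernel_primitive p A B 0)"
  proof (rule parts_diff_bound)
    show "0 \<le> 1 * (t * (2 * p - t))" if "0 < t" "t < m" for t
      using that assms by simp
  qed (use assms in simp_all)
  then show ?thesis by simp
qed

text \<open>The kernel changes sign at 2 p, within [0, m]. Writing P for
  \<open>kernel_primitive\<close>, the two pieces contribute P(2 p) and P(2 p) - P(m).\<close>

lemma parts_bound_early_sign_change:
  assumes "0 \<le> p" "m \<le> 1" "2 * p \<le> m"
  shows "\<bar>parts p g\<^sub>1 g G m - parts p g\<^sub>1 g G 0\<bar>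
           \<le> 2 * kernel_primitive p A B (2 * p) - kernel_primitive p A B m"
proof -
  have "\<bar>parts p g\<^sub>1 g G (2 * p) - parts p g\<^sub>1 g G 0\<bar> \<le> kernel_primitive p A B (2 * p)"
    using assms by (intro parts_bound_late_sign_change) auto
  moreover have "\<bar>parts p g\<^sub>1 g G m - parts p g\<^sub>1 g G (2 * p)\<bar>
      \<le> kernel_primitive p A B (2 * p) - kernel_primitive p A B m"
  proof -
    have "\<bar>parts p g\<^sub>1 g G m - parts p g\<^sub>1 g G (2 * p)\<bar>
        \<le> -1 * (kernel_primitive p A B m - kernel_primitive p A B (2 * p))"
    proof (rule parts_diff_bound)
      show "0 \<le> -1 * (t * (2 * p - t))" if "2 * p < t" "t < m" for t
        using that assms(1) mult_nonneg_nonpos[of t "2 * p - t"] by simp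
    qed (use assms in simp_all)
    then show ?thesis by simp
  qed
  ultimately show ?thesis by linarith
qed

end

text \<open>Carries the piece [1 - \<alpha>, 1] to [0, \<alpha>], where the bounds starting at 0
  apply. Each differentiation brings a factor -1, hence the signs; the end-point bounds trade
  places.\<close>

lemma second_derivative_bound_reflect:
  assumes "second_derivative_bound G g g\<^sub>1 g\<^sub>2 A B"
  shows "second_derivative_bound (\<lambda>t. - G (1 - t)) (\<lambda>t. g (1 - t)) (\<lambda>t. - g\<^sub>1 (1 - t))
           (\<lambda>t. g\<^sub>2 (1 - t)) B A"
proof -
  interpret second_derivative_bound G g g\<^sub>1 g\<^sub>2 A B by fact
  have reflect_deriv: "((\<lambda>t. h (1 - t)) has_real_derivative - h') (at t)"
    if "(h has_real_derivative h') (at (1 - t))" for h :: "real \<Rightarrow> real" and h' t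
  proof -
    have "((\<lambda>t::real. 1 - t) has_real_derivative -1) (at t)"
      by (auto intro!: derivative_eq_intros)
    from DERIV_chain2[OF that this] show ?thesis by simp
  qed
  have reflect_cont: "continuous_on {0..1} (\<lambda>t. h (1 - t))"
    if "continuous_on {0..1} h" for h :: "real \<Rightarrow> real"
    by (rule continuous_on_compose2[OF that]) (auto intro!: continuous_intros)
  show ?thesis
  proof
    fix t :: real assume "0 < t" "t < 1"
    then have t: "0 < 1 - t" "1 - t < 1" by auto
    show "((\<lambda>t. - G (1 - t)) has_real_derivative g (1 - t)) (at t)"
      using DERIV_minus[OF reflect_deriv[OF G_deriv[OF t]]] by simp
    show "((\<lambda>t. g (1 - t)) has_real_derivative - g\<^sub>1 (1 - t)) (at t)"
      by (rule reflect_deriv[OF g_deriv[OF t]])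
    show "((\<lambda>t. - g\<^sub>1 (1 - t)) has_real_derivative g\<^sub>2 (1 - t)) (at t)"
      using DERIV_minus[OF reflect_deriv[OF g\<^sub>1_deriv[OF t]]] by simp
    show "\<bar>g\<^sub>2 (1 - t)\<bar> \<le> t * A + (1 - t) * B"
      using g\<^sub>2_bound[OF t] by simp
  qed (intro continuous_on_minus reflect_cont G_cont g_cont g\<^sub>1_cont)+
qed

section \<open>The constants as values of \<open>kernel_primitive\<close>\<close>

lemma \<gamma>\<^sub>1_\<gamma>\<^sub>2_eq:
  "2 * kernel_primitive (\<alpha> * lam) A B (2 * (\<alpha> * lam)) - kernel_primitive (\<alpha> * lam) A B (1 - \<alpha>)
     = \<gamma>\<^sub>1 \<alpha> lam * B + \<gamma>\<^sub>2 \<alpha> lam * A"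
  \<comment> \<open>With p = \<alpha> lam, doubling the primitive at its critical point 2 p gives
    8/3 p^4 for \<open>B\<close> and 8/3 p^3 (1 - p) for \<open>A\<close>, the leading terms of the
    two constants.\<close>
  unfolding kernel_primitive_def \<gamma>\<^sub>1_def \<gamma>\<^sub>2_def by (simp add: algebra_simps power2_eq_square power3_eq_cube power4_eq_xxxx
      add_divide_distrib diff_divide_distrib)

lemma \<gamma>\<^sub>3_\<gamma>\<^sub>4_eq:
  "kernel_primitive (\<alpha> * lam) A B (1 - \<alpha>) = \<gamma>\<^sub>3 \<alpha> lam * B + \<gamma>\<^sub>4 \<alpha> lam * A"
  unfolding kernel_primitive_def \<gamma>\<^sub>3_def \<gamma>\<^sub>4_def by (simp add: algebra_simps power2_eq_square power3_eq_cube power4_eq_xxxx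
      add_divide_distrib diff_divide_distrib)

text \<open>Besides \<alpha>, only q enters; once lam is eliminated, all powers of q above the first
  cancel. What remains is the coefficient of \<open>A\<close> in
  \<open>kernel_primitive q A B \<alpha>\<close>.\<close>

lemma \<mu>\<^sub>3_eq:
  fixes \<alpha> lam :: real
  defines "q \<equiv> lam * (1 - \<alpha>)"
  shows "\<mu>\<^sub>3 \<alpha> lam = q * \<alpha>^2 - (1 + 2 * q) * \<alpha>^3 / 3 + \<alpha>^4 / 4"
proof -
  have e1: "4 * lam * (1 - \<alpha>)^2 * (1 - lam) = 4 * q * (1 - \<alpha> - q)"
    unfolding q_def by algebra
  have e2: "4/3 * (1 - \<alpha>)^3 * lam^3 = 4/3 * q^3"
    by (simp add: q_def power_mult_distrib)
  have "\<mu>\<^sub>3 \<alpha> lam = 4/3 * q^3 * (1 - q)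
      + 1/12 * (\<alpha> - 2 * q)^2 * (\<alpha> * (3 * \<alpha> - 4) - 4 * q * (1 - \<alpha> - q))"
    unfolding \<mu>\<^sub>3_def e1 e2 by (simp only: q_def mult.assoc)
  then show ?thesis by (simp add: algebra_simps power2_eq_square power3_eq_cube power4_eq_xxxx
      add_divide_distrib diff_divide_distrib)
qed

text \<open>The product (\<alpha> - 2 q)^2 (3 \<alpha>^2 + 4 \<alpha> q + 4 q^2) equals 3 \<alpha>^4
  - 8 \<alpha>^3 q + 16 q^4, whose last term removes 4/3 q^4.\<close>

lemma \<mu>\<^sub>4_eq:
  fixes \<alpha> lam :: real
  defines "q \<equiv> lam * (1 - \<alpha>)"
  shows "\<mu>\<^sub>4 \<alpha> lam = 2 * q * \<alpha>^3 / 3 - \<alpha>^4 / 4"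
proof -
  have "\<alpha>^2 * (4 * lam^2 - 4 * lam + 3) + 4 * \<alpha> * lam * (1 - 2 * lam) + 4 * lam^2
      = 3 * \<alpha>^2 + 4 * \<alpha> * q + 4 * q^2"
    unfolding q_def by algebra
  moreover have "4/3 * (1 - \<alpha>)^4 * lam^4 = 4/3 * q^4"
    by (simp add: q_def power_mult_distrib)
  ultimately have "\<mu>\<^sub>4 \<alpha> lam = 4/3 * q^4
      - 1/12 * (\<alpha> - 2 * q)^2 * (3 * \<alpha>^2 + 4 * \<alpha> * q + 4 * q^2)"
    by (simp add: \<mu>\<^sub>4_def q_def mult.assoc)
  then show ?thesis by (simp add: algebra_simps power2_eq_square power3_eq_cube power4_eq_xxxx
      add_divide_distrib diff_divide_distrib)
qed

text \<open>Reflection swaps the end points, so \<open>A\<close> and \<open>B\<close> enter in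
  exchanged order and the odd index belongs to the weight 1 - t of the reflected variable.\<close>

lemma \<mu>\<^sub>3_\<mu>\<^sub>4_eq:
  "kernel_primitive (lam * (1 - \<alpha>)) B A \<alpha> = \<mu>\<^sub>3 \<alpha> lam * B + \<mu>\<^sub>4 \<alpha> lam * A"
  by (simp add: kernel_primitive_def \<mu>\<^sub>3_eq \<mu>\<^sub>4_eq mult.commute add.commute)

text \<open>\<open>\<mu>\<^sub>1\<close> and \<open>\<mu>\<^sub>3\<close> differ only in the sign of
  their second summand, as do \<open>\<mu>\<^sub>2\<close> and \<open>\<mu>\<^sub>4\<close>. Their
  sums are therefore the coefficients of the doubled primitive at 2 q.\<close>

lemma \<mu>\<^sub>1_\<mu>\<^sub>2_eq:
  "2 * kernel_primitive (lam * (1 - \<alpha>)) B A (2 * (lam * (1 - \<alpha>)))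
       - kernel_primitive (lam * (1 - \<alpha>)) B A \<alpha>
     = \<mu>\<^sub>1 \<alpha> lam * B + \<mu>\<^sub>2 \<alpha> lam * A"
proof -
  define q where "q = lam * (1 - \<alpha>)"
  have q3: "(1 - \<alpha>)^3 * lam^3 = q^3" and q4: "(1 - \<alpha>)^4 * lam^4 = q^4"
    by (simp_all add: q_def power_mult_distrib)
  have "\<mu>\<^sub>1 \<alpha> lam + \<mu>\<^sub>3 \<alpha> lam = 8/3 * ((1 - \<alpha>)^3 * lam^3) * (1 - q)"
    by (simp add: \<mu>\<^sub>1_def \<mu>\<^sub>3_def q_def mult.assoc)
  then have \<mu>\<^sub>1: "\<mu>\<^sub>1 \<alpha> lam = 8/3 * q^3 * (1 - q) - \<mu>\<^sub>3 \<alpha> lam"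
    unfolding q3 by linarith
  have "\<mu>\<^sub>2 \<alpha> lam + \<mu>\<^sub>4 \<alpha> lam = 8/3 * ((1 - \<alpha>)^4 * lam^4)"
    by (simp add: \<mu>\<^sub>2_def \<mu>\<^sub>4_def mult.assoc)
  then have \<mu>\<^sub>2: "\<mu>\<^sub>2 \<alpha> lam = 8/3 * q^4 - \<mu>\<^sub>4 \<alpha> lam"
    unfolding q4 by linarith
  have "2 * kernel_primitive q B A (2 * q) = 8/3 * q^3 * (1 - q) * B + 8/3 * q^4 * A"
    unfolding kernel_primitive_def
    by (simp add: algebra_simps power2_eq_square power3_eq_cube power4_eq_xxxx
      add_divide_distrib diff_divide_distrib)
  then show ?thesis
    unfolding \<mu>\<^sub>3_\<mu>\<^sub>4_eq \<mu>\<^sub>1 \<mu>\<^sub>2 by (simp add: q_def left_diff_distrib)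
qed

section \<open>Rescaling to the unit interval and assembling the four cases\<close>

theorem theorem3:
  fixes I :: "real set" and f f' f'' :: "real \<Rightarrow> real" and a b \<alpha> lam :: real
  assumes "is_interval I"
    and "a \<in> interior I" and "b \<in> interior I" and "a < b"
    and "\<And>x. x \<in> interior I \<Longrightarrow> (f has_real_derivative f' x) (at x)"
    and "\<And>x. x \<in> interior I \<Longrightarrow> (f' has_real_derivative f'' x) (at x)"
    and "set_integrable lebesgue {a..b} f"
    and "set_integrable lebesgue {a..b} f'"
    and "set_integrable lebesgue {a..b} f''"
    and "\<alpha> \<in> {0..1}" and "lam \<in> {0..1}"
    and "convex_on {a..b} (\<lambda>x. \<bar>f'' x\<bar>)"
  shows
    "(2 * \<alpha> * lam \<le> 1 - \<alpha> \<and> 1 - \<alpha> \<le> 1 - 2 * lam * (1 - \<alpha>) \<longrightarrow>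
        \<bar>E f f' a b \<alpha> lam\<bar> \<le> (b - a)^2 / 2 *
          ((\<gamma>\<^sub>1 \<alpha> lam + \<mu>\<^sub>1 \<alpha> lam) * \<bar>f'' b\<bar> + (\<gamma>\<^sub>2 \<alpha> lam + \<mu>\<^sub>2 \<alpha> lam) * \<bar>f'' a\<bar>)) \<and>
     (1 - \<alpha> \<ge> max (2 * \<alpha> * lam) (1 - 2 * lam * (1 - \<alpha>)) \<longrightarrow>
        \<bar>E f f' a b \<alpha> lam\<bar> \<le> (b - a)^2 / 2 *
          ((\<gamma>\<^sub>1 \<alpha> lam + \<mu>\<^sub>3 \<alpha> lam) * \<bar>f'' b\<bar> + (\<gamma>\<^sub>2 \<alpha> lam + \<mu>\<^sub>4 \<alpha> lam) * \<bar>f'' a\<bar>)) \<and>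
     (1 - \<alpha> \<le> min (2 * \<alpha> * lam) (1 - 2 * lam * (1 - \<alpha>)) \<longrightarrow>
        \<bar>E f f' a b \<alpha> lam\<bar> \<le> (b - a)^2 / 2 *
          ((\<gamma>\<^sub>3 \<alpha> lam + \<mu>\<^sub>1 \<alpha> lam) * \<bar>f'' b\<bar> + (\<gamma>\<^sub>4 \<alpha> lam + \<mu>\<^sub>2 \<alpha> lam) * \<bar>f'' a\<bar>)) \<and>
     (1 - 2 * lam * (1 - \<alpha>) \<le> 1 - \<alpha> \<and> 1 - \<alpha> \<le> 2 * \<alpha> * lam \<longrightarrow>
        \<bar>E f f' a b \<alpha> lam\<bar> \<le> (b - a)^2 / 2 *
          ((\<gamma>\<^sub>3 \<alpha> lam + \<mu>\<^sub>3 \<alpha> lam) * \<bar>f'' b\<bar> + (\<gamma>\<^sub>4 \<alpha> lam + \<mu>\<^sub>4 \<alpha> lam) * \<bar>f'' a\<bar>))"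
proof -
  define L where "L = b - a"
  define x where "x t = a + t * L" for t
  define F where "F y = integral {a..y} f" for y
  \<comment> \<open>Dividing by \<open>L\<close> undoes the factor from dx = L dt, so that G' = f o
    x.\<close>
  define G where "G t = F (x t) / L" for t
  have L: "L > 0" using \<open>a < b\<close> by (simp add: L_def)
  \<comment> \<open>All of [a, b] lies in the interior, so f and f' are continuous up to the end
    points.\<close>
  have "is_interval (interior I)"
    using assms(1) by (simp add: is_interval_convex_1 convex_interior)
  then have ab: "{a..b} \<subseteq> interior I"
    using assms(2,3) by (meson atLeastAtMost_iff mem_is_interval_1_I subsetI)
  have cont: "continuous_on {a..b} f" "continuous_on {a..b} f'"
    using assms(5,6) ab by (meson DERIV_isCont continuous_at_imp_continuous_on subsetD)+
  have F_deriv: "(F has_real_derivative f y) (at y within {a..b})" if "y \<in> {a..b}" for y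
    unfolding F_def by (rule integral_has_real_derivative[OF cont(1) that])
  have x_diff: "x t - a = t * L" "b - x t = (1 - t) * L" for t
    by (simp_all add: x_def L_def algebra_simps)
  have x_mem: "x t \<in> {a..b}" if "t \<in> {0..1}" for t
  proof -
    have "0 \<le> x t - a" "0 \<le> b - x t"
      unfolding x_diff using that L by simp_all
    then show ?thesis by simp
  qed
  have x_deriv: "(x has_real_derivative L) (at t)" for t
    unfolding x_def by (auto intro!: derivative_eq_intros)
  have x_cont: "continuous_on {0..1} (\<lambda>t. h (x t))"
    if "continuous_on {a..b} h" for h :: "real \<Rightarrow> real"
    using x_mem
    by (intro continuous_on_compose2[OF that]) (auto simp: x_def intro!: continuous_intros)
  have x_01: "x 0 = a" "x 1 = b" by (simp_all add: x_def L_def)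
  have x_split: "x (1 - \<alpha>) = (1 - \<alpha>) * b + \<alpha> * a"
    by (simp add: x_def L_def algebra_simps)

  interpret left: second_derivative_bound G "\<lambda>t. f (x t)" "\<lambda>t. L * f' (x t)"
    "\<lambda>t. L\<^sup>2 * f'' (x t)" "L\<^sup>2 * \<bar>f'' a\<bar>" "L\<^sup>2 * \<bar>f'' b\<bar>"
  proof
    fix t :: real assume t: "0 < t" "t < 1"
    have "0 < x t - a" "0 < b - x t"
      unfolding x_diff using t L by simp_all
    then have xt: "a < x t" "x t < b" by simp_all
    \<comment> \<open>\<open>F_deriv\<close> is relative to [a, b]; at interior points it is a full
      derivative, which is why the locale asks for derivatives on the open interval.\<close>
    have "(F has_real_derivative f (x t)) (at (x t))"
      using F_deriv[of "x t"] xt at_within_interior[of "x t" "{a..b}"] by auto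
    from DERIV_cdivide[OF DERIV_chain2[OF this x_deriv], of L]
    show "(G has_real_derivative f (x t)) (at t)"
      using L by (simp add: G_def[abs_def])
    have xI: "x t \<in> interior I" using ab xt by auto
    show "((\<lambda>t. f (x t)) has_real_derivative L * f' (x t)) (at t)"
      using DERIV_chain2[OF assms(5)[OF xI] x_deriv] by (simp add: mult.commute)
    show "((\<lambda>t. L * f' (x t)) has_real_derivative L\<^sup>2 * f'' (x t)) (at t)"
      using DERIV_cmult[OF DERIV_chain2[OF assms(6)[OF xI] x_deriv], of L]
      by (simp add: power2_eq_square ac_simps)
    have "x t = (1 - t) *\<^sub>R a + t *\<^sub>R b" by (simp add: x_def L_def algebra_simps)
    then have "\<bar>f'' (x t)\<bar> \<le> (1 - t) * \<bar>f'' a\<bar> + t * \<bar>f'' b\<bar>"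
      using convex_onD[OF assms(12), of t a b] t \<open>a < b\<close> by simp
    then have "L\<^sup>2 * \<bar>f'' (x t)\<bar> \<le> L\<^sup>2 * ((1 - t) * \<bar>f'' a\<bar> + t * \<bar>f'' b\<bar>)"
      by (intro mult_left_mono) auto
    then show "\<bar>L\<^sup>2 * f'' (x t)\<bar> \<le> t * (L\<^sup>2 * \<bar>f'' b\<bar>) + (1 - t) * (L\<^sup>2 * \<bar>f'' a\<bar>)"
      by (simp add: abs_mult algebra_simps)
  next
    have "continuous_on {a..b} F"
      using F_deriv DERIV_continuous continuous_on_eq_continuous_within by blast
    then show "continuous_on {0..1} G"
      unfolding G_def using L by (intro continuous_intros x_cont) auto
    show "continuous_on {0..1} (\<lambda>t. f (x t))" "continuous_on {0..1} (\<lambda>t. L * f' (x t))"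
      by (intro continuous_intros x_cont cont)+
  qed
  interpret right: second_derivative_bound "\<lambda>t. - G (1 - t)" "\<lambda>t. f (x (1 - t))"
    "\<lambda>t. - (L * f' (x (1 - t)))" "\<lambda>t. L\<^sup>2 * f'' (x (1 - t))" "L\<^sup>2 * \<bar>f'' b\<bar>" "L\<^sup>2 * \<bar>f'' a\<bar>"
    by (rule second_derivative_bound_reflect[OF left.second_derivative_bound_axioms])

  define p where "p = \<alpha> * lam"
  define q where "q = lam * (1 - \<alpha>)"
  define X where "X = parts p (\<lambda>t. L * f' (x t)) (\<lambda>t. f (x t)) G (1 - \<alpha>)
     - parts p (\<lambda>t. L * f' (x t)) (\<lambda>t. f (x t)) G 0"
  define Y where "Y = parts q (\<lambda>t. - (L * f' (x (1 - t)))) (\<lambda>t. f (x (1 - t))) (\<lambda>t. - G (1 - t)) \<alpha>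
     - parts q (\<lambda>t. - (L * f' (x (1 - t)))) (\<lambda>t. f (x (1 - t))) (\<lambda>t. - G (1 - t)) 0"
  \<comment> \<open>Integrability of f identifies the gauge integral behind \<open>F\<close> with
    the Lebesgue integral in \<open>E\<close>.\<close>
  have G_01: "G 1 = (LINT x:{a..b}|lebesgue. f x) / L" "G 0 = 0"
    using set_lebesgue_integral_eq_integral(2)[OF assms(7)] by (simp_all add: G_def F_def x_01)
  \<comment> \<open>The values G(1 - \<alpha>) cancel. At the split point p (1 - \<alpha>) = q
    \<alpha> leaves \<alpha>^2 - (1 - \<alpha>)^2 = 2 \<alpha> - 1 for f', and p + q = lam leaves 2
    (1 - lam) for f.\<close>
  have "2 * E f f' a b \<alpha> lam = X + Y"
    unfolding X_def Y_def parts_def p_def q_def E_def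
    by (simp add: x_01 x_split G_01 flip: L_def) (simp add: algebra_simps power2_eq_square)
  then have E_le: "\<bar>E f f' a b \<alpha> lam\<bar> \<le> (\<bar>X\<bar> + \<bar>Y\<bar>) / 2"
    using abs_triangle_ineq[of X Y] by (metis abs_mult abs_numeral le_divide_eq_numeral1(1) mult.commute)
  have bounds: "0 \<le> \<alpha>" "\<alpha> \<le> 1" "0 \<le> p" "0 \<le> q"
    using assms(10,11) by (auto simp: p_def q_def)
  have X_early: "\<bar>X\<bar> \<le> L\<^sup>2 * (\<gamma>\<^sub>1 \<alpha> lam * \<bar>f'' b\<bar> + \<gamma>\<^sub>2 \<alpha> lam * \<bar>f'' a\<bar>)"
    if "2 * \<alpha> * lam \<le> 1 - \<alpha>"
    using left.parts_bound_early_sign_change[of p "1 - \<alpha>"] bounds that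
    unfolding X_def p_def \<gamma>\<^sub>1_\<gamma>\<^sub>2_eq by (simp add: algebra_simps)
  have X_late: "\<bar>X\<bar> \<le> L\<^sup>2 * (\<gamma>\<^sub>3 \<alpha> lam * \<bar>f'' b\<bar> + \<gamma>\<^sub>4 \<alpha> lam * \<bar>f'' a\<bar>)"
    if "1 - \<alpha> \<le> 2 * \<alpha> * lam"
    using left.parts_bound_late_sign_change[of "1 - \<alpha>" p] bounds that
    unfolding X_def p_def \<gamma>\<^sub>3_\<gamma>\<^sub>4_eq by (simp add: algebra_simps)
  \<comment> \<open>The hypothesis amounts to 2 q \<le> \<alpha>: the reflected kernel changes sign
    within [0, \<alpha>].\<close>
  have Y_early: "\<bar>Y\<bar> \<le> L\<^sup>2 * (\<mu>\<^sub>1 \<alpha> lam * \<bar>f'' b\<bar> + \<mu>\<^sub>2 \<alpha> lam * \<bar>f'' a\<bar>)"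
    if "1 - \<alpha> \<le> 1 - 2 * lam * (1 - \<alpha>)"
    using right.parts_bound_early_sign_change[of q \<alpha>] bounds that
    unfolding Y_def q_def \<mu>\<^sub>1_\<mu>\<^sub>2_eq by (simp add: algebra_simps)
  have Y_late: "\<bar>Y\<bar> \<le> L\<^sup>2 * (\<mu>\<^sub>3 \<alpha> lam * \<bar>f'' b\<bar> + \<mu>\<^sub>4 \<alpha> lam * \<bar>f'' a\<bar>)"
    if "1 - 2 * lam * (1 - \<alpha>) \<le> 1 - \<alpha>"
    using right.parts_bound_late_sign_change[of \<alpha> q] bounds that
    unfolding Y_def q_def \<mu>\<^sub>3_\<mu>\<^sub>4_eq by (simp add: algebra_simps)
  \<comment> \<open>Each case pairs one bound for \<open>X\<close> with one for \<open>Y\<close>;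
    free coefficients serve all four pairings at once.\<close>
  have combine: "\<bar>E f f' a b \<alpha> lam\<bar> \<le> (b - a)\<^sup>2 / 2 * ((c + d) * \<bar>f'' b\<bar> + (c' + d') * \<bar>f'' a\<bar>)"
    if "\<bar>X\<bar> \<le> L\<^sup>2 * (c * \<bar>f'' b\<bar> + c' * \<bar>f'' a\<bar>)" "\<bar>Y\<bar> \<le> L\<^sup>2 * (d * \<bar>f'' b\<bar> + d' * \<bar>f'' a\<bar>)"
    for c c' d d'
  proof -
    have "\<bar>E f f' a b \<alpha> lam\<bar>
        \<le> (L\<^sup>2 * (c * \<bar>f'' b\<bar> + c' * \<bar>f'' a\<bar>) + L\<^sup>2 * (d * \<bar>f'' b\<bar> + d' * \<bar>f'' a\<bar>)) / 2"
      by (rule order_trans[OF E_le divide_right_mono[OF add_mono[OF that]]]) simp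
    also have "\<dots> = (b - a)\<^sup>2 / 2 * ((c + d) * \<bar>f'' b\<bar> + (c' + d') * \<bar>f'' a\<bar>)"
      by (simp add: L_def field_simps)
    finally show ?thesis .
  qed
  show ?thesis
    by (intro conjI impI combine X_early X_late Y_early Y_late) auto
qed

end
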